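(* Let $(\widetilde A_0,\dots,\widetilde A_{Q_a},\widetilde B_0,\dots,\widetilde B_{Q_u},\widetilde C_1,\dots,\widetilde C_{Q_l})\in\mathcal R$ be an allowable tuple of DDROM matrices, with associated reduced state $\widehat x(\mu)$, output $\widehat y(\mu)$ and dual state $\widehat x_d(\mu)$, and let $$\mathcal J=\|y-\widehat y\|_{L^2(\Gamma,\mathbb P)}^2=\int_\Gamma |y(\mu)-\widehat y(\mu)|^2\,d\mathbb P(\mu).$$ Then the gradients of $\mathcal J$ with respect to the individual matrices of the tuple (at this tuple) are $$\nabla_{\widetilde A_0}\mathcal J=2\int_\Gamma \widehat x_d(\mu)\,[y(\mu)-\widehat y(\mu)]\,\widehat x(\mu)^T\,d\mathbb P(\mu),$$ $$\nabla_{\widetilde A_q}\mathcal J=2\int_\Gamma \widetilde Q_a^q(\mu)\,\widehat x_d(\mu)\,[y(\mu)-\widehat y(\mu)]\,\widehat x(\mu)^T\,d\mathbb P(\mu),\qquad q=1,\dots,Q_a,$$ $$\nabla_{\widetilde B_0}\mathcal J=2\int_\Gamma \widehat x_d(\mu)\,[\widehat y(\mu)-y(\mu)]\,d\mathbb P(\mu),$$ $$\nabla_{\widetilde B_p}\mathcal J=2\int_\Gamma \widetilde Q_u^p(\mu)\,\widehat x_d(\mu)\,[\widehat y(\mu)-y(\mu)]\,d\mathbb P(\mu),\qquad p=1,\dots,Q_u,$$ $$\nabla_{\widetilde C_k}\mathcal J=2\int_\Gamma \widetilde Q_l^k(\mu)\,[\widehat y(\mu)-y(\mu)]\,\widehat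 x(\mu)^T\,d\mathbb P(\mu),\qquad k=1,\dots,Q_l.$$
   Context: **Data.** $(\Gamma,\Sigma,\mathbb P)$ is a measure space and $y:\Gamma\to\mathbb R$ is a given function in $L^2(\Gamma,\mathbb P)$. $Q_a,Q_u,Q_l$ are positive integers, and $\widetilde Q_a^q$ ($1\le q\le Q_a$), $\widetilde Q_u^p$ ($1\le p\le Q_u$), $\widetilde Q_l^k$ ($1\le k\le Q_l$) are given measurable functions $\Gamma\to\mathbb R$ satisfying the standing assumption $$\int_\Gamma\left\{\frac{\bigl(1+\sum_{p=1}^{Q_u}|\widetilde Q_u^p(\mu)|\bigr)\sum_{k=1}^{Q_l}|\widetilde Q_l^k(\mu)|}{1+\sum_{q=1}^{Q_a}|\widetilde Q_a^q(\mu)|}\right\}^2 d\mathbb P(\mu)<\infty .$$ $\beta>0$ is a fixed real number, $n_1,n_2$ are positive integers, and $r=n_1+2n_2$. $\|\cdot\|_{\mathcal F}$ is the Frobenius norm and $\langle X,Y\rangle_{\mathcal F}=\mathrm{tr}(X^TY)$ the Frobenius inner product. **DDROM matrices.** A tuple of DDROM (data-driven reduced-order model) matrices is a tuple $(\widetilde A_0,\dots,\widetilde A_{Q_a},\widetilde B_0,\dots,\widetilde B_{Q_u},\widetilde C_1,\dots,\widetilde C_{Q_l})$ with $\widetilde A_q\in\mathbb R^{r\times r}$, $\widetilde B_p\in\mathbb R^{r\times 1}$, $\widetilde C_k\in\mathbb R^{1\times r}$ (real entries), of the block form (block sizes $n_1,n_2,n_2$) $$\widetilde A_0=\begin{bmatrix}2\beta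 \widetilde M_1&0&-\widetilde M_2^T\\0&\widetilde M_3&0\\-\widetilde M_2&0&0\end{bmatrix},\quad \widetilde A_q=\begin{bmatrix}0&0&0\\0&0&(\widetilde K^q)^T\\0&\widetilde K^q&0\end{bmatrix}\ (q\ge1),\quad \widetilde B_0=\begin{bmatrix}0\\0\\\widetilde d\end{bmatrix},\quad \widetilde B_p=\begin{bmatrix}0\\\widetilde U_p\\0\end{bmatrix}\ (p\ge1),$$ where $\widetilde M_1\in\mathbb R^{n_1\times n_1}$, $\widetilde M_2\in\mathbb R^{n_2\times n_1}$, $\widetilde M_3,\widetilde K^q\in\mathbb R^{n_2\times n_2}$, $\widetilde d,\widetilde U_p\in\mathbb R^{n_2}$, and the $\widetilde C_k$ are arbitrary. For any tuple of matrices of these sizes (block-structured or not) write $$\mathbf A(\mu)=\widetilde A_0+\sum_{q=1}^{Q_a}\widetilde Q_a^q(\mu)\widetilde A_q,\qquad \mathbf B(\mu)=\widetilde B_0+\sum_{p=1}^{Q_u}\widetilde Q_u^p(\mu)\widetilde B_p,\qquad \mathbf C(\mu)=\sum_{k=1}^{Q_l}\widetilde Q_l^k(\mu)\widetilde C_k .$$ **Allowable set.** $\mathcal R$ is the set of all tuples of DDROM matrices such that $\mathbf A(\mu)$ is invertible for $\mathbb P$-almost every $\mu\in\Gamma$ and $$\operatorname*{ess\,sup}_{\mu\in\Gamma}\Bigl(1+\sum_{q=1}^{Q_a}|\widetilde Q_a^q(\mu)|\Bigr)\bigl\|\mathbf A(\mu)^{-1}\bigr\|_{\mathcal F}<\infty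 .$$ **State, output, dual state.** For almost every $\mu$, $\widehat x(\mu)\in\mathbb R^r$, $\widehat y(\mu)\in\mathbb R$ and $\widehat x_d(\mu)\in\mathbb R^r$ are defined by $$\mathbf A(\mu)\widehat x(\mu)=\mathbf B(\mu),\qquad \widehat y(\mu)=\mathbf C(\mu)\widehat x(\mu),\qquad \mathbf A(\mu)^T\widehat x_d(\mu)=\mathbf C(\mu)^T .$$ **Gradients.** $\mathcal J$ is regarded as a function of the matrices of the tuple, by the same formula $\mathcal J=\int_\Gamma|y-\mathbf C\mathbf A^{-1}\mathbf B|^2\,d\mathbb P$, also for nearby tuples that need not have the block form. The gradient with respect to one matrix $X$ of the tuple (the other matrices held fixed) is the matrix $\nabla_X\mathcal J$ of the same size as $X$ such that $\mathcal J(X+\Delta X)=\mathcal J(X)+\langle\nabla_X\mathcal J,\Delta X\rangle_{\mathcal F}+o(\|\Delta X\|_{\mathcal F})$ as $\|\Delta X\|_{\mathcal F}\to0$, over arbitrary (unstructured) real perturbations $\Delta X$ of that size. *)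

theory Defs
  imports "HOL-Analysis.Analysis" "HOL-Probability.Essential_Supremum"
begin

text \<open>An \<open>m \<times> n\<close> matrix has type \<open>real^'n^'m\<close>. On this type the library's \<open>norm\<close> and \<open>inner\<close> are
  the Frobenius norm and the Frobenius inner product, so \<open>GDERIV\<close> is the gradient with respect
  to unstructured matrix perturbations.

  Column vectors are \<open>r \<times> 1\<close> matrices and row vectors are \<open>1 \<times> r\<close> matrices. Tuples indexed by
  \<open>0, \<dots>, n\<close> or \<open>1, \<dots>, n\<close> are functions on \<open>nat\<close> whose values at other indices are never used.\<close>

definition affine_comb ::
  "nat \<Rightarrow> (nat \<Rightarrow> 'g \<Rightarrow> real) \<Rightarrow> (nat \<Rightarrow> 'v::real_vector) \<Rightarrow> 'g \<Rightarrow> 'v"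
  where "affine_comb n Q X \<mu> = X 0 + (\<Sum>q=1..n. Q q \<mu> *\<^sub>R X q)"

definition linear_comb ::
  "nat \<Rightarrow> (nat \<Rightarrow> 'g \<Rightarrow> real) \<Rightarrow> (nat \<Rightarrow> 'v::real_vector) \<Rightarrow> 'g \<Rightarrow> 'v"
  where "linear_comb n Q X \<mu> = (\<Sum>k=1..n. Q k \<mu> *\<^sub>R X k)"

text \<open>With the index type \<open>'a + 'b + 'c\<close>, the blocks of a matrix are selected by the injections
  into the sum. The arguments of the next two definitions list the blocks row by row.\<close>

definition block33 ::
  "real^'a^'a \<Rightarrow> real^'b^'a \<Rightarrow> real^'c^'a \<Rightarrow>
   real^'a^'b \<Rightarrow> real^'b^'b \<Rightarrow> real^'c^'b \<Rightarrow>
   real^'a^'c \<Rightarrow> real^'b^'c \<Rightarrow> real^'c^'c \<Rightarrow> real^('a + 'b + 'c)^('a + 'b + 'c)"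
  where
  "block33 X11 X12 X13 X21 X22 X23 X31 X32 X33 = (\<chi> i j.
     (case i of
        Inl a \<Rightarrow> (case j of Inl a' \<Rightarrow> X11 $ a $ a' | Inr (Inl b') \<Rightarrow> X12 $ a $ b' | Inr (Inr c') \<Rightarrow> X13 $ a $ c')
      | Inr (Inl b) \<Rightarrow> (case j of Inl a' \<Rightarrow> X21 $ b $ a' | Inr (Inl b') \<Rightarrow> X22 $ b $ b' | Inr (Inr c') \<Rightarrow> X23 $ b $ c')
      | Inr (Inr c) \<Rightarrow> (case j of Inl a' \<Rightarrow> X31 $ c $ a' | Inr (Inl b') \<Rightarrow> X32 $ c $ b' | Inr (Inr c') \<Rightarrow> X33 $ c $ c')))"

definition block31 :: "real^1^'a \<Rightarrow> real^1^'b \<Rightarrow> real^1^'c \<Rightarrow> real^1^('a + 'b + 'c)"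
  where
  "block31 X1 X2 X3 = (\<chi> i j.
     (case i of Inl a \<Rightarrow> X1 $ a $ j | Inr (Inl b) \<Rightarrow> X2 $ b $ j | Inr (Inr c) \<Rightarrow> X3 $ c $ j))"

text \<open>The output matrices \<open>C\<close> of a tuple of DDROM matrices are unrestricted.\<close>

definition ddrom_matrices ::
  "real \<Rightarrow> nat \<Rightarrow> nat \<Rightarrow>
   ((nat \<Rightarrow> real^('n1::finite + 'n2::finite + 'n2)^('n1 + 'n2 + 'n2)) \<times>
    (nat \<Rightarrow> real^1^('n1 + 'n2 + 'n2)) \<times>
    (nat \<Rightarrow> real^('n1 + 'n2 + 'n2)^1)) set"
  where
  "ddrom_matrices \<beta> na nu = {(A, B, C).
     (\<exists>(M1 :: real^'n1::finite^'n1) (M2 :: real^'n1^'n2::finite) (M3 :: real^'n2^'n2) (K :: nat \<Rightarrow> real^'n2^'n2)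
        (d :: real^1^'n2) (U :: nat \<Rightarrow> real^1^'n2).
        A 0 = block33 ((2 * \<beta>) *\<^sub>R M1) 0  (- transpose M2)
                      0                 M3 0
                      (- M2)            0  0 \<and>
        (\<forall>q\<in>{1..na}. A q = block33 0 0     0
                                   0 0     (transpose (K q))
                                   0 (K q) 0) \<and>
        B 0 = block31 0 0 d \<and>
        (\<forall>p\<in>{1..nu}. B p = block31 0 (U p) 0))}"

definition allowable_set ::
  "'g measure \<Rightarrow> real \<Rightarrow> nat \<Rightarrow> (nat \<Rightarrow> 'g \<Rightarrow> real) \<Rightarrow> nat \<Rightarrow>
   ((nat \<Rightarrow> real^('n1::finite + 'n2::finite + 'n2)^('n1 + 'n2 + 'n2)) \<times>
    (nat \<Rightarrow> real^1^('n1 + 'n2 + 'n2)) \<times>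
    (nat \<Rightarrow> real^('n1 + 'n2 + 'n2)^1)) set"
  where
  "allowable_set M \<beta> na Qa nu = {(A, B, C). (A, B, C) \<in> ddrom_matrices \<beta> na nu \<and>
     (AE \<mu> in M. invertible (affine_comb na Qa A \<mu>)) \<and>
     esssup M (\<lambda>\<mu>. ereal ((1 + (\<Sum>q=1..na. \<bar>Qa q \<mu>\<bar>)) *
                          norm (matrix_inv (affine_comb na Qa A \<mu>)))) < \<infinity>}"

definition cost_integrand ::
  "('g \<Rightarrow> real) \<Rightarrow>
   nat \<Rightarrow> (nat \<Rightarrow> 'g \<Rightarrow> real) \<Rightarrow> nat \<Rightarrow> (nat \<Rightarrow> 'g \<Rightarrow> real) \<Rightarrow> nat \<Rightarrow> (nat \<Rightarrow> 'g \<Rightarrow> real) \<Rightarrow>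
   (nat \<Rightarrow> real^'r^'r) \<Rightarrow> (nat \<Rightarrow> real^1^'r) \<Rightarrow> (nat \<Rightarrow> real^'r^1) \<Rightarrow> 'g \<Rightarrow> real"
  where
  "cost_integrand y na Qa nu Qu nl Ql A B C \<mu> =
     \<bar>y \<mu> - (linear_comb nl Ql C \<mu> ** matrix_inv (affine_comb na Qa A \<mu>)
              ** affine_comb nu Qu B \<mu>) $ 1 $ 1\<bar>\<^sup>2"

definition cost ::
  "'g measure \<Rightarrow> ('g \<Rightarrow> real) \<Rightarrow>
   nat \<Rightarrow> (nat \<Rightarrow> 'g \<Rightarrow> real) \<Rightarrow> nat \<Rightarrow> (nat \<Rightarrow> 'g \<Rightarrow> real) \<Rightarrow> nat \<Rightarrow> (nat \<Rightarrow> 'g \<Rightarrow> real) \<Rightarrow>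
   (nat \<Rightarrow> real^'r^'r) \<Rightarrow> (nat \<Rightarrow> real^1^'r) \<Rightarrow> (nat \<Rightarrow> real^'r^1) \<Rightarrow> real"
  where
  "cost M y na Qa nu Qu nl Ql A B C = (\<integral>\<mu>. cost_integrand y na Qa nu Qu nl Ql A B C \<mu> \<partial>M)"

text \<open>Both \<open>matrix_inv\<close> and the Bochner integral are total, so \<open>cost\<close> has its intended meaning
  only where the following predicate holds.\<close>

definition cost_well_defined ::
  "'g measure \<Rightarrow> ('g \<Rightarrow> real) \<Rightarrow>
   nat \<Rightarrow> (nat \<Rightarrow> 'g \<Rightarrow> real) \<Rightarrow> nat \<Rightarrow> (nat \<Rightarrow> 'g \<Rightarrow> real) \<Rightarrow> nat \<Rightarrow> (nat \<Rightarrow> 'g \<Rightarrow> real) \<Rightarrow>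
   (nat \<Rightarrow> real^'r^'r) \<Rightarrow> (nat \<Rightarrow> real^1^'r) \<Rightarrow> (nat \<Rightarrow> real^'r^1) \<Rightarrow> bool"
  where
  "cost_well_defined M y na Qa nu Qu nl Ql A B C \<longleftrightarrow>
     (AE \<mu> in M. invertible (affine_comb na Qa A \<mu>)) \<and>
     integrable M (cost_integrand y na Qa nu Qu nl Ql A B C)"

end

theory Submission
  imports Defs
begin

text \<open>Write \<open>s\<close> for the weight \<open>1 + \<Sum>\<bar>Qa q\<bar>\<close>, and \<open>D\<close> for the inverse of \<open>\<^bold>A\<close>. For almost every \<open>\<mu>\<close>, the output
  \<open>\<^bold>C D \<^bold>B\<close> is a smooth function of the matrices, and the chain rule gives the formulas; the work is in
  making all estimates uniform enough in \<open>\<mu>\<close> to integrate them.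

  Allowability says \<open>s \<parallel>D\<parallel> \<le> R\<close> almost everywhere. A perturbation of \<open>A\<close> of size \<open>\<epsilon>\<close> changes \<open>\<^bold>A(\<mu>)\<close> by a
  matrix \<open>E\<close> with \<open>\<parallel>E\<parallel> \<le> \<epsilon> s\<close>, so \<open>\<parallel>D\<parallel> \<parallel>E\<parallel> \<le> R \<epsilon>\<close> with no dependence on \<open>\<mu>\<close>: one small \<open>\<epsilon>\<close> serves for all
  \<open>\<mu>\<close> at once, the perturbed matrix stays invertible, and its inverse \<open>D'\<close> satisfies \<open>s \<parallel>D'\<parallel> \<le> 2 R\<close>
  (\<open>matrix_inv_perturbation\<close>, \<open>perturbed_allowable\<close>). Bounding \<open>\<^bold>B\<close> and \<open>\<^bold>C\<close> in the same manner, every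
  output near the given tuple is dominated by a multiple of
  \<open>(1 + \<Sum>\<bar>Qu p\<bar>) (\<Sum>\<bar>Ql k\<bar>) / (1 + \<Sum>\<bar>Qa q\<bar>)\<close>, the function \<open>envelope\<close> that the standing assumption puts
  into \<open>L\<^sup>2\<close>.

  The output is affine in \<open>B\<close> and in \<open>C\<close>. In \<open>A\<close>, the exact second order identity
  \<open>D' = D - D E D + D E D' E D\<close> turns the increment of the output into
  \<open>- xd\<^sup>T E xh + xd\<^sup>T E D' E xh\<close>. Here \<open>E = Qa q(\<mu>) H\<close> (with the coefficient \<open>1\<close> for \<open>q = 0\<close>), the first term is the inner product of \<open>H\<close> with
  \<open>- Qa q(\<mu>) xd xh\<^sup>T\<close>, and the second is at most a constant times \<open>envelope \<mu> \<parallel>H\<parallel>\<^sup>2\<close>: the two factors of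
  \<open>E\<close> contribute \<open>s\<^sup>2\<close>, while \<open>D'\<close>, \<open>xh\<close> and \<open>xd\<close> contribute \<open>1/s\<close> each.

  In all cases the output is therefore differentiable with an \<open>L\<^sup>2\<close>-bounded gradient and an
  \<open>L\<^sup>2\<close>-bounded quadratic remainder. Expanding the square and integrating leaves a quadratic
  remainder for the mean square error (\<open>GDERIV_mean_square\<close>), without any interchange of limit and
  integral.\<close>

section \<open>Frobenius norm and matrix products\<close>

lemma norm_transpose: "norm (transpose X) = norm (X :: real^'n^'m)"
proof -
  have "(norm (transpose X))\<^sup>2 = (norm X)\<^sup>2"
    unfolding power2_norm_eq_inner inner_vec_def transpose_def
    by simp (rule sum.swap)
  then show ?thesis by simp
qed

lemma norm_matrix_mult_le:
  "norm (X ** Y) \<le> norm X * norm Y" for X :: "real^'k^'m" and Y :: "real^'n^'k"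
proof -
  have "(norm (X ** Y))\<^sup>2 = (\<Sum>i\<in>UNIV. \<Sum>j\<in>UNIV. (X $ i \<bullet> transpose Y $ j)\<^sup>2)"
    unfolding power2_norm_eq_inner
    by (simp add: inner_vec_def matrix_matrix_mult_def transpose_def power2_eq_square)
  also have "\<dots> \<le> (\<Sum>i\<in>UNIV. \<Sum>j\<in>UNIV. (norm (X $ i))\<^sup>2 * (norm (transpose Y $ j))\<^sup>2)"
    unfolding power2_norm_eq_inner by (intro sum_mono Cauchy_Schwarz_ineq)
  also have "\<dots> = (norm X)\<^sup>2 * (norm (transpose Y))\<^sup>2"
    unfolding power2_norm_eq_inner inner_vec_def[of X] inner_vec_def[of "transpose Y"]
    by (simp add: sum_product)
  also have "\<dots> = (norm X * norm Y)\<^sup>2"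
    by (simp add: norm_transpose power_mult_distrib)
  finally show ?thesis by (rule power2_le_imp_le) simp
qed

interpretation matmul: bounded_bilinear
  "(**) :: real^'k^'m \<Rightarrow> real^'n^'k \<Rightarrow> real^'n^'m"
proof
  fix X X' :: "real^'k^'m" and Y Y' :: "real^'n^'k" and r :: real
  show "(X + X') ** Y = X ** Y + X' ** Y" "X ** (Y + Y') = X ** Y + X ** Y'"
    "(r *\<^sub>R X) ** Y = r *\<^sub>R (X ** Y)" "X ** (r *\<^sub>R Y) = r *\<^sub>R (X ** Y)"
    by (simp_all add: matrix_matrix_mult_def vec_eq_iff algebra_simps sum.distrib sum_distrib_left)
  show "\<exists>K. \<forall>X Y. norm ((X :: real^'k^'m) ** (Y :: real^'n^'k)) \<le> norm X * norm Y * K"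
    by (rule exI[of _ 1]) (simp add: norm_matrix_mult_le)
qed

lemma norm_matrix_vector_mult_le:
  "norm (X *v v) \<le> norm X * norm v" for X :: "real^'n^'m"
proof -
  have "(norm (X *v v))\<^sup>2 = (\<Sum>i\<in>UNIV. (X $ i \<bullet> v)\<^sup>2)"
    unfolding power2_norm_eq_inner
    by (simp add: inner_vec_def matrix_vector_mult_def power2_eq_square)
  also have "\<dots> \<le> (\<Sum>i\<in>UNIV. (norm (X $ i))\<^sup>2 * (norm v)\<^sup>2)"
    unfolding power2_norm_eq_inner by (intro sum_mono Cauchy_Schwarz_ineq)
  also have "\<dots> = (norm X * norm v)\<^sup>2"
    unfolding power_mult_distrib power2_norm_eq_inner inner_vec_def[of X] by (simp add: sum_distrib_right)
  finally show ?thesis by (rule power2_le_imp_le) simp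
qed

lemma abs_entry_le_norm: "\<bar>X $ i $ j\<bar> \<le> norm (X :: real^'n^'m)"
  using component_le_norm_cart[of "X $ i" j] Finite_Cartesian_Product.norm_nth_le[of X i] by linarith

lemma norm_matrix_mult3_le:
  fixes X :: "real^'k^'m" and Y :: "real^'l^'k" and Z :: "real^'n^'l"
  assumes "norm X \<le> a" "norm Y \<le> b" "norm Z \<le> c"
  shows "norm (X ** Y ** Z) \<le> a * b * c"
proof -
  have 1: "norm (X ** Y) \<le> a * b"
    using norm_matrix_mult_le[of X Y] mult_mono[OF assms(1,2)] norm_ge_zero[of X] norm_ge_zero[of Y] assms(1) by linarith
  show ?thesis
    using norm_matrix_mult_le[of "X ** Y" Z] mult_mono[OF 1 assms(3)] norm_ge_zero[of Z] 1
      norm_ge_zero[of "X**Y"] by linarith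
qed

text \<open>The next three identities read off a gradient from a derivative: they write the scalar outputs
  produced by a perturbation \<open>H\<close> of \<open>A\<close>, \<open>B\<close> or \<open>C\<close> as Frobenius inner products with \<open>H\<close>.\<close>
lemma inner_rank_one: "H \<bullet> (x ** transpose z) = (transpose x ** H ** z) $ 1 $ 1"
  for H :: "real^'r^'r" and x z :: "real^1^'r"
  by (simp add: inner_vec_def matrix_matrix_mult_def transpose_def sum_distrib_left sum_distrib_right mult_ac)
    (rule sum.swap)

lemma inner_column: "H \<bullet> x = (transpose x ** H) $ 1 $ 1" for H x :: "real^1^'r"
  by (simp add: inner_vec_def matrix_matrix_mult_def transpose_def mult.commute)

lemma inner_row: "H \<bullet> transpose x = (H ** x) $ 1 $ 1" for H :: "real^'r^1" and x :: "real^1^'r"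
  by (simp add: inner_vec_def matrix_matrix_mult_def transpose_def mult.commute)

section \<open>Inverses of perturbed matrices\<close>

lemma matrix_inv_of_invertible:
  fixes D :: "real^'r^'r"
  assumes "invertible D"
  shows "D ** matrix_inv D = mat 1" "matrix_inv D ** D = mat 1"
  using assms unfolding invertible_def matrix_inv_def by (metis (mono_tags, lifting) someI_ex)+

text \<open>Smallness of \<open>D E\<close> makes the kernel of \<open>X + E\<close> trivial, and the
  estimate and the expansion come from inserting the resolvent identity \<open>D' = D - D E D'\<close> and its mirror
  image \<open>D' = D - D' E D\<close> into each other.\<close>
lemma matrix_inv_perturbation:
  fixes X E :: "real^'r^'r"
  assumes X: "invertible X" and small: "norm (matrix_inv X) * norm E \<le> 1/2"
  defines "D \<equiv> matrix_inv X" and "D' \<equiv> matrix_inv (X + E)"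
  shows "invertible (X + E)"
    and "norm D' \<le> 2 * norm D"
    and "D' - D = - (D ** E ** D')"
    and "D' = D - D ** E ** D + D ** E ** D' ** E ** D"
proof -
  note DX = matrix_inv_of_invertible[OF X, folded D_def]
  have DE: "norm (D ** E) \<le> 1/2"
    using norm_matrix_mult_le[of D E] small by (simp add: D_def)
  have expand: "D ** (X + E) = mat 1 + D ** E"
    by (simp add: matmul.add_right DX)
  \<comment> \<open>Multiplying by \<open>D\<close> shows that a kernel vector is reproduced up to sign by the contraction \<open>D E\<close>.\<close>
  have "v = 0" if v: "(X + E) *v v = 0" for v
  proof -
    have "(mat 1 + D ** E) *v v = 0"
      using v by (metis expand matrix_vector_mul_assoc matrix_vector_mult_0_right)
    then have veq: "v = - ((D ** E) *v v)"
      by (simp add: matrix_vector_mult_add_rdistrib eq_neg_iff_add_eq_0)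
    have "norm ((D ** E) *v v) \<le> norm (D ** E) * norm v"
      by (rule norm_matrix_vector_mult_le)
    also have "\<dots> \<le> 1/2 * norm v"
      using DE by (rule mult_right_mono) simp
    finally have "norm v \<le> 1/2 * norm v"
      using veq by (metis norm_minus_cancel)
    then show ?thesis by simp
  qed
  then show inv: "invertible (X + E)"
    unfolding invertible_left_inverse matrix_left_invertible_ker by blast
  note DX' = matrix_inv_of_invertible[OF inv, folded D'_def]
  have "D = D ** (X + E) ** D'"
    by (simp add: DX' flip: matrix_mul_assoc)
  also have "\<dots> = D' + D ** E ** D'"
    by (simp add: expand matmul.add_left)
  finally show diff: "D' - D = - (D ** E ** D')" by (simp add: algebra_simps)
  have "D = D' ** (X + E) ** D"
    by (simp add: DX')
  also have "\<dots> = D' + D' ** E ** D"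
    by (simp add: matmul.add_right matmul.add_left DX flip: matrix_mul_assoc)
  finally have diff2: "D' = D - D' ** E ** D" by (simp add: algebra_simps)
  have D'_eq: "D - D ** E ** D' = D'" using diff by (simp add: algebra_simps)
  then have "D' = D - (D - D ** E ** D') ** E ** D"
    using diff2 by (simp only:)
  then show "D' = D - D ** E ** D + D ** E ** D' ** E ** D"
    unfolding matmul.diff_left diff_diff_eq2 diff_add_eq .
  have "norm D' \<le> norm D + norm (D ** E ** D')"
    using norm_triangle_ineq4[of D "D ** E ** D'"] by (simp only: D'_eq)
  also have "norm (D ** E ** D') \<le> 1/2 * norm D'"
    using norm_matrix_mult_le[of "D ** E" D'] mult_right_mono[OF DE, of "norm D'"] by simp
  finally show "norm D' \<le> 2 * norm D" by simp
qed

lemma continuous_on_matrix_inv: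
  "continuous_on {X :: real^'r^'r. invertible X} matrix_inv"
  unfolding continuous_on_iff
proof (intro ballI allI impI)
  fix X :: "real^'r^'r" and e :: real
  assume X: "X \<in> {X. invertible X}" and e: "e > 0"
  define N where "N = norm (matrix_inv X) + 1"
  have N: "N \<ge> 1" by (simp add: N_def)
  \<comment> \<open>The first bound makes the perturbation lemma applicable, the second makes the resulting estimate
    \<open>2 * N * N * d\<close> at most \<open>e\<close>.\<close>
  define d where "d = min (1 / (2 * N)) (e / (2 * N * N))"
  show "\<exists>d>0. \<forall>X'\<in>{X. invertible X}. dist X' X < d \<longrightarrow> dist (matrix_inv X') (matrix_inv X) < e"
  proof (intro exI conjI ballI impI)
    show "d > 0" using N e by (simp add: d_def)
    fix X' :: "real^'r^'r"
    assume "dist X' X < d"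
    then have E: "norm (X' - X) < d" by (simp add: dist_norm)
    have "norm (matrix_inv X) * norm (X' - X) \<le> N * (1 / (2 * N))"
      using E by (intro mult_mono) (auto simp: N_def d_def)
    then have small: "norm (matrix_inv X) * norm (X' - X) \<le> 1/2" using N by simp
    note P = matrix_inv_perturbation[OF _ small]
    have "norm (matrix_inv X' - matrix_inv X) \<le> norm (matrix_inv X) * norm (X' - X) * norm (matrix_inv X')"
      using P(3) X norm_matrix_mult3_le[OF order_refl order_refl order_refl, of "matrix_inv X" "X' - X" "matrix_inv X'"]
      by simp
    also have "\<dots> \<le> N * norm (X' - X) * (2 * N)"
      using P(2) X by (intro mult_mono) (auto simp: N_def)
    also have "\<dots> < N * (e / (2 * N * N)) * (2 * N)"
      using E N by (intro mult_strict_right_mono mult_strict_left_mono) (auto simp: d_def)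
    also have "\<dots> = e" using N by simp
    finally show "dist (matrix_inv X') (matrix_inv X) < e" by (simp add: dist_norm)
  qed
qed

text \<open>On the closed set of singular matrices the choice operator in \<open>matrix_inv\<close> ranges over the empty
  predicate, hence returns one fixed matrix there. So \<open>matrix_inv\<close> is continuous on an open set and
  constant off it, which makes the cost integrand measurable everywhere, including on the null set
  where the system matrix is singular. This matters because the measure need not be complete.\<close>
lemma borel_measurable_matrix_inv:
  "(matrix_inv :: real^'r^'r \<Rightarrow> real^'r^'r) \<in> borel_measurable borel"
proof -
  define c :: "real^'r^'r" where "c = (SOME Y. False)"
  have eq: "matrix_inv = (\<lambda>X :: real^'r^'r. if X \<in> {X. invertible X} then matrix_inv X else c)"
    unfolding fun_eq_iff matrix_inv_def invertible_def c_def
    by (auto intro!: arg_cong[of _ _ Eps])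
  have "continuous_on UNIV (det :: real^'r^'r \<Rightarrow> real)"
    unfolding det_def by (intro continuous_intros)
  then have "open {X :: real^'r^'r. det X \<noteq> 0}"
    by (intro open_Collect_neq continuous_on_const)
  then have "{X :: real^'r^'r. invertible X} \<in> sets borel"
    by (simp add: invertible_det_nz)
  then show ?thesis
    by (subst eq) (intro borel_measurable_continuous_on_if continuous_on_matrix_inv continuous_on_const)
qed

lemma borel_measurable_matrix_mult:
  fixes f :: "'g \<Rightarrow> real^'k^'m" and g :: "'g \<Rightarrow> real^'n^'k"
  assumes "f \<in> borel_measurable M" "g \<in> borel_measurable M"
  shows "(\<lambda>x. f x ** g x) \<in> borel_measurable M"
  using assms by (rule borel_measurable_continuous_Pair) (intro matmul.continuous_on continuous_intros)

lemma borel_measurable_transpose: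
  fixes f :: "'g \<Rightarrow> real^'n^'m"
  assumes "f \<in> borel_measurable M"
  shows "(\<lambda>x. transpose (f x)) \<in> borel_measurable M"
proof -
  have "continuous_on UNIV (transpose :: real^'n^'m \<Rightarrow> _)"
    unfolding transpose_def by (intro continuous_intros)
  then have "transpose \<in> borel_measurable (borel :: (real^'n^'m) measure)"
    by (rule borel_measurable_continuous_onI)
  with assms show ?thesis by (rule measurable_compose)
qed

lemma borel_measurable_entry:
  fixes f :: "'g \<Rightarrow> real^'n^'m"
  assumes "f \<in> borel_measurable M"
  shows "(\<lambda>x. f x $ i $ j) \<in> borel_measurable M"
proof -
  have "continuous_on UNIV (\<lambda>X :: real^'n^'m. X $ i $ j)"
    by (intro continuous_intros)
  then have "(\<lambda>X :: real^'n^'m. X $ i $ j) \<in> borel_measurable borel"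
    by (rule borel_measurable_continuous_onI)
  with assms show ?thesis by (rule measurable_compose)
qed

section \<open>Differentiating a mean square error\<close>

lemma GDERIV_quadratic_remainder:
  fixes f :: "'v::real_inner \<Rightarrow> real"
  assumes "e > 0" and bound: "\<And>h. norm h < e \<Longrightarrow> \<bar>f (x + h) - f x - h \<bullet> D\<bar> \<le> K * (norm h)\<^sup>2"
  shows "GDERIV f x :> D"
  unfolding gderiv_def has_derivative_at
proof
  show "bounded_linear (\<lambda>h. h \<bullet> D)" by (rule bounded_linear_inner_left)
  show "(\<lambda>h. norm (f (x + h) - f x - h \<bullet> D) / norm h) \<midarrow>0\<rightarrow> 0"
  proof (rule Lim_null_comparison)
    show "\<forall>\<^sub>F h in at 0. norm (norm (f (x + h) - f x - h \<bullet> D) / norm h) \<le> K * norm h"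
      unfolding eventually_at
    proof (intro exI[of _ e] conjI ballI impI \<open>e > 0\<close>)
      fix h :: 'v assume "h \<noteq> 0 \<and> dist h 0 < e"
      then have h: "h \<noteq> 0" "norm h < e" by auto
      show "norm (norm (f (x + h) - f x - h \<bullet> D) / norm h) \<le> K * norm h"
        using bound[OF h(2)] h(1) by (simp add: divide_le_eq power2_eq_square mult.assoc)
    qed
    show "(\<lambda>h::'v. K * norm h) \<midarrow>0\<rightarrow> 0"
      by (intro tendsto_mult_right_zero tendsto_norm_zero tendsto_ident_at)
  qed
qed

lemma integrable_mult_square:
  fixes f g :: "'g \<Rightarrow> real"
  assumes [measurable]: "f \<in> borel_measurable M" "g \<in> borel_measurable M"
    and "integrable M (\<lambda>x. (f x)\<^sup>2)" "integrable M (\<lambda>x. (g x)\<^sup>2)"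
  shows "integrable M (\<lambda>x. \<bar>f x\<bar> * \<bar>g x\<bar>)"
proof (rule Bochner_Integration.integrable_bound)
  show "integrable M (\<lambda>x. (f x)\<^sup>2 + (g x)\<^sup>2)" using assms by simp
  have "\<bar>a\<bar> * \<bar>b\<bar> \<le> a\<^sup>2 + b\<^sup>2" for a b :: real
    using sum_squares_bound[of "\<bar>a\<bar>" "\<bar>b\<bar>"] mult_nonneg_nonneg[OF abs_ge_zero abs_ge_zero, of a b]
    unfolding power2_abs by linarith
  then show "AE x in M. norm (\<bar>f x\<bar> * \<bar>g x\<bar>) \<le> norm ((f x)\<^sup>2 + (g x)\<^sup>2)" by (simp add: abs_mult)
qed measurable

text \<open>With residual \<open>r\<close>, output increment \<open>d\<close>, its linear part \<open>a\<close> and step length \<open>t\<close>, the new squared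
  residual differs from its linearization by \<open>d\<^sup>2 - 2 r (d - a)\<close>, and both terms are of order \<open>t\<^sup>2\<close>. The
  bound is a fixed integrable function times \<open>t\<^sup>2\<close> once \<open>r\<close> and \<open>w\<close> are square integrable.\<close>
lemma square_difference_expansion:
  fixes r a d w K t e :: real
  assumes lin: "\<bar>d - a\<bar> \<le> K * w * t\<^sup>2" and a: "\<bar>a\<bar> \<le> K * w * t"
    and "0 \<le> K" "0 \<le> w" "0 \<le> t" "t \<le> e"
  shows "\<bar>(r - d)\<^sup>2 - r\<^sup>2 + 2 * r * a\<bar> \<le> (2 * K * (\<bar>r\<bar> * \<bar>w\<bar>) + (K * (1 + e))\<^sup>2 * w\<^sup>2) * t\<^sup>2"
proof -
  have Kwt: "0 \<le> K * w * t" using assms by simp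
  have "K * w * t\<^sup>2 \<le> K * w * t * e"
    using mult_left_mono[OF \<open>t \<le> e\<close> Kwt] by (simp add: power2_eq_square mult.assoc)
  then have "\<bar>d\<bar> \<le> K * w * t * (1 + e)" using lin a by (simp add: algebra_simps)
  then have d2: "d\<^sup>2 \<le> (K * w * t * (1 + e))\<^sup>2"
    by (rule power2_le_iff_abs_le[THEN iffD2, rotated]) (use Kwt assms in auto)
  have "(r - d)\<^sup>2 - r\<^sup>2 + 2 * r * a = d\<^sup>2 - 2 * r * (d - a)" by (simp add: power2_eq_square algebra_simps)
  then have "\<bar>(r - d)\<^sup>2 - r\<^sup>2 + 2 * r * a\<bar> \<le> d\<^sup>2 + 2 * (\<bar>r\<bar> * \<bar>d - a\<bar>)"
    using abs_triangle_ineq4[of "d\<^sup>2" "2 * r * (d - a)"] by (simp add: abs_mult)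
  also have "\<dots> \<le> (K * w * t * (1 + e))\<^sup>2 + 2 * (\<bar>r\<bar> * (K * w * t\<^sup>2))"
    using d2 mult_left_mono[OF lin, of "\<bar>r\<bar>"] by simp
  also have "\<dots> = (2 * K * (\<bar>r\<bar> * \<bar>w\<bar>) + (K * (1 + e))\<^sup>2 * w\<^sup>2) * t\<^sup>2"
    using \<open>0 \<le> w\<close> by (simp add: power2_eq_square algebra_simps)
  finally show ?thesis .
qed

text \<open>The analytic core, free of matrices: \<open>Y X\<close> is a model output depending on a parameter \<open>X\<close>, and \<open>g\<close>
  its pointwise gradient at \<open>X0\<close>. The exceptional null set may depend on the perturbation, since the pointwise
  estimate is integrated for each perturbation separately.\<close>
lemma GDERIV_mean_square:
  fixes Y :: "'v::euclidean_space \<Rightarrow> 'g \<Rightarrow> real" and g :: "'g \<Rightarrow> 'v" and y yh w :: "'g \<Rightarrow> real"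
  assumes "e > 0" "K \<ge> 0"
    and meas [measurable]: "y \<in> borel_measurable M" "yh \<in> borel_measurable M" "g \<in> borel_measurable M"
      "w \<in> borel_measurable M"
    and w: "\<And>\<mu>. w \<mu> \<ge> 0" "integrable M (\<lambda>\<mu>. (w \<mu>)\<^sup>2)"
    and yh: "AE \<mu> in M. Y X0 \<mu> = yh \<mu>"
    and int: "\<And>h. norm h < e \<Longrightarrow> integrable M (\<lambda>\<mu>. (y \<mu> - Y (X0 + h) \<mu>)\<^sup>2)"
    and g: "AE \<mu> in M. norm (g \<mu>) \<le> K * w \<mu>"
    and lin: "\<And>h. norm h < e \<Longrightarrow> AE \<mu> in M. \<bar>Y (X0 + h) \<mu> - yh \<mu> - h \<bullet> g \<mu>\<bar> \<le> K * w \<mu> * (norm h)\<^sup>2"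
  shows "integrable M (\<lambda>\<mu>. (yh \<mu> - y \<mu>) *\<^sub>R g \<mu>)"
    and "GDERIV (\<lambda>X. \<integral>\<mu>. (y \<mu> - Y X \<mu>)\<^sup>2 \<partial>M) X0 :> 2 *\<^sub>R (\<integral>\<mu>. (yh \<mu> - y \<mu>) *\<^sub>R g \<mu> \<partial>M)"
proof -
  have int0: "integrable M (\<lambda>\<mu>. (y \<mu> - yh \<mu>)\<^sup>2)"
    by (rule integrable_cong_AE_imp[OF int[of 0]]) (use \<open>e > 0\<close> yh in auto)
  have rw: "integrable M (\<lambda>\<mu>. \<bar>y \<mu> - yh \<mu>\<bar> * \<bar>w \<mu>\<bar>)"
    by (rule integrable_mult_square) (use int0 w in auto)
  show intg: "integrable M (\<lambda>\<mu>. (yh \<mu> - y \<mu>) *\<^sub>R g \<mu>)"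
  proof (rule Bochner_Integration.integrable_bound)
    show "integrable M (\<lambda>\<mu>. K * (\<bar>y \<mu> - yh \<mu>\<bar> * \<bar>w \<mu>\<bar>))" using rw by simp
    show "AE \<mu> in M. norm ((yh \<mu> - y \<mu>) *\<^sub>R g \<mu>) \<le> norm (K * (\<bar>y \<mu> - yh \<mu>\<bar> * \<bar>w \<mu>\<bar>))"
      using g
    proof eventually_elim
      case (elim \<mu>)
      then show ?case
        using mult_left_mono[OF elim, of "\<bar>yh \<mu> - y \<mu>\<bar>"] w(1)[of \<mu>] \<open>K \<ge> 0\<close>
        by (simp add: abs_mult abs_minus_commute mult_ac)
    qed
  qed measurable
  let ?G = "\<integral>\<mu>. (yh \<mu> - y \<mu>) *\<^sub>R g \<mu> \<partial>M"
  let ?b = "\<lambda>\<mu>. 2 * K * (\<bar>y \<mu> - yh \<mu>\<bar> * \<bar>w \<mu>\<bar>) + (K * (1 + e))\<^sup>2 * (w \<mu>)\<^sup>2"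
  have intb: "integrable M ?b" using rw w by simp
  show "GDERIV (\<lambda>X. \<integral>\<mu>. (y \<mu> - Y X \<mu>)\<^sup>2 \<partial>M) X0 :> 2 *\<^sub>R ?G"
  proof (rule GDERIV_quadratic_remainder[OF \<open>e > 0\<close>, where K = "integral\<^sup>L M ?b"])
    fix h :: 'v assume h: "norm h < e"
    let ?R = "\<lambda>\<mu>. (y \<mu> - Y (X0 + h) \<mu>)\<^sup>2 - (y \<mu> - yh \<mu>)\<^sup>2 - 2 * (h \<bullet> ((yh \<mu> - y \<mu>) *\<^sub>R g \<mu>))"
    have J0: "(\<integral>\<mu>. (y \<mu> - Y X0 \<mu>)\<^sup>2 \<partial>M) = (\<integral>\<mu>. (y \<mu> - yh \<mu>)\<^sup>2 \<partial>M)"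
    proof (rule integral_cong_AE)
      show "(\<lambda>\<mu>. (y \<mu> - Y X0 \<mu>)\<^sup>2) \<in> borel_measurable M"
        using int[of 0] \<open>e > 0\<close> by simp
    qed (use yh in auto)
    have inth: "integrable M (\<lambda>\<mu>. h \<bullet> ((yh \<mu> - y \<mu>) *\<^sub>R g \<mu>))"
      by (rule integrable_inner_right) (rule intg)
    have "(\<integral>\<mu>. h \<bullet> ((yh \<mu> - y \<mu>) *\<^sub>R g \<mu>) \<partial>M) = h \<bullet> ?G"
      by (rule integral_inner_right) (rule intg)
    then have eq: "(\<integral>\<mu>. (y \<mu> - Y (X0 + h) \<mu>)\<^sup>2 \<partial>M) - (\<integral>\<mu>. (y \<mu> - Y X0 \<mu>)\<^sup>2 \<partial>M) - h \<bullet> (2 *\<^sub>R ?G)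
       = integral\<^sup>L M ?R"
      unfolding J0 using int[OF h] int0 inth by simp
    have intR: "integrable M ?R" using int[OF h] int0 inth by simp
    have "AE \<mu> in M. norm (?R \<mu>) \<le> ?b \<mu> * (norm h)\<^sup>2"
      using lin[OF h] g
    proof eventually_elim
      case (elim \<mu>)
      have "\<bar>h \<bullet> g \<mu>\<bar> \<le> norm h * norm (g \<mu>)" by (rule Cauchy_Schwarz_ineq2)
      also have "\<dots> \<le> norm h * (K * w \<mu>)" using elim(2) by (rule mult_left_mono) simp
      finally have "\<bar>h \<bullet> g \<mu>\<bar> \<le> K * w \<mu> * norm h" by (simp add: mult_ac)
      from square_difference_expansion[OF elim(1) this \<open>K \<ge> 0\<close> w(1) norm_ge_zero less_imp_le[OF h], of "y \<mu> - yh \<mu>"]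
      show ?case by (simp add: algebra_simps)
    qed
    moreover have "integrable M (\<lambda>\<mu>. ?b \<mu> * (norm h)\<^sup>2)"
      by (rule integrable_mult_left) (rule intb)
    ultimately have "norm (integral\<^sup>L M ?R) \<le> (\<integral>\<mu>. ?b \<mu> * (norm h)\<^sup>2 \<partial>M)"
      using intR by (intro order_trans[OF integral_norm_bound integral_mono_AE] integrable_norm)
    then show "\<bar>(\<integral>\<mu>. (y \<mu> - Y (X0 + h) \<mu>)\<^sup>2 \<partial>M) - (\<integral>\<mu>. (y \<mu> - Y X0 \<mu>)\<^sup>2 \<partial>M) - h \<bullet> (2 *\<^sub>R ?G)\<bar>
        \<le> integral\<^sup>L M ?b * (norm h)\<^sup>2"
      unfolding eq by simp
  qed
qed

section \<open>Parameter-dependent combinations of matrices\<close>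

text \<open>Giving the constant term the coefficient \<open>1\<close> lets the index \<open>0\<close> be treated together with the others.\<close>
definition affine_coeff :: "(nat \<Rightarrow> 'g \<Rightarrow> real) \<Rightarrow> nat \<Rightarrow> 'g \<Rightarrow> real"
  where "affine_coeff Q q \<mu> = (if q = 0 then 1 else Q q \<mu>)"

definition weight :: "nat \<Rightarrow> (nat \<Rightarrow> 'g \<Rightarrow> real) \<Rightarrow> 'g \<Rightarrow> real"
  where "weight n Q \<mu> = 1 + (\<Sum>q=1..n. \<bar>Q q \<mu>\<bar>)"

lemma weight_ge_1: "1 \<le> weight n Q \<mu>"
  by (simp add: weight_def sum_nonneg)

lemma abs_affine_coeff_le_weight: "q \<le> n \<Longrightarrow> \<bar>affine_coeff Q q \<mu>\<bar> \<le> weight n Q \<mu>"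
  using member_le_sum[of q "{1..n}" "\<lambda>q. \<bar>Q q \<mu>\<bar>"] weight_ge_1[of n Q \<mu>]
  by (auto simp: affine_coeff_def weight_def)

lemma affine_coeff_0: "affine_coeff Q 0 \<mu> = 1"
  by (simp add: affine_coeff_def)

lemma affine_coeff_of_pos: "q \<in> {1..n} \<Longrightarrow> affine_coeff Q q = Q q"
  by (auto simp: affine_coeff_def)

lemma affine_comb_eq_sum: "affine_comb n Q X \<mu> = (\<Sum>q=0..n. affine_coeff Q q \<mu> *\<^sub>R X q)"
  unfolding affine_comb_def affine_coeff_def by (subst sum.atLeast_Suc_atMost) auto

lemma weight_eq_sum: "weight n Q \<mu> = (\<Sum>q=0..n. \<bar>affine_coeff Q q \<mu>\<bar>)"
  unfolding weight_def affine_coeff_def by (subst (2) sum.atLeast_Suc_atMost) auto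

lemma norm_affine_comb_le:
  fixes X :: "nat \<Rightarrow> 'v::real_normed_vector"
  assumes "\<And>q. q \<in> {0..n} \<Longrightarrow> norm (X q) \<le> b"
  shows "norm (affine_comb n Q X \<mu>) \<le> weight n Q \<mu> * b"
  unfolding affine_comb_eq_sum weight_eq_sum sum_distrib_right
  by (rule sum_norm_le) (simp add: assms mult_left_mono)

lemma norm_linear_comb_le:
  fixes X :: "nat \<Rightarrow> 'v::real_normed_vector"
  assumes "\<And>k. k \<in> {1..n} \<Longrightarrow> norm (X k) \<le> b"
  shows "norm (linear_comb n Q X \<mu>) \<le> (\<Sum>k=1..n. \<bar>Q k \<mu>\<bar>) * b"
  unfolding linear_comb_def sum_distrib_right
  by (rule sum_norm_le) (use assms in \<open>simp add: mult_left_mono\<close>)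

lemma affine_comb_diff:
  "affine_comb n Q X' \<mu> = affine_comb n Q X \<mu> + affine_comb n Q (\<lambda>q. X' q - X q) \<mu>"
  unfolding affine_comb_eq_sum by (simp add: scaleR_diff_right sum_subtractf)

lemma affine_comb_update:
  assumes "q \<le> n"
  shows "affine_comb n Q (X(q := X q + H)) \<mu> = affine_comb n Q X \<mu> + affine_coeff Q q \<mu> *\<^sub>R H"
proof -
  have "affine_coeff Q j \<mu> *\<^sub>R (X(q := X q + H)) j = affine_coeff Q j \<mu> *\<^sub>R X j + (if j = q then affine_coeff Q q \<mu> *\<^sub>R H else 0)" for j
    by (simp add: scaleR_add_right)
  then show ?thesis
    unfolding affine_comb_eq_sum using assms by (simp add: sum.distrib)
qed

lemma linear_comb_update:
  assumes "k \<in> {1..n}"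
  shows "linear_comb n Q (X(k := X k + H)) \<mu> = linear_comb n Q X \<mu> + Q k \<mu> *\<^sub>R H"
proof -
  have "Q j \<mu> *\<^sub>R (X(k := X k + H)) j = Q j \<mu> *\<^sub>R X j + (if j = k then Q k \<mu> *\<^sub>R H else 0)" for j
    by (simp add: scaleR_add_right)
  then show ?thesis
    unfolding linear_comb_def using assms by (simp add: sum.distrib)
qed

lemma borel_measurable_affine_coeff:
  assumes "\<And>q. q \<in> {1..n} \<Longrightarrow> Q q \<in> borel_measurable M" and "q \<le> n"
  shows "affine_coeff Q q \<in> borel_measurable M"
  using assms by (cases "q = 0") (auto simp: affine_coeff_def[abs_def])

lemma borel_measurable_affine_comb:
  fixes X :: "nat \<Rightarrow> 'v::euclidean_space"
  assumes "\<And>q. q \<in> {1..n} \<Longrightarrow> Q q \<in> borel_measurable M"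
  shows "affine_comb n Q X \<in> borel_measurable M"
  unfolding affine_comb_def
  by (intro borel_measurable_add borel_measurable_sum borel_measurable_scaleR borel_measurable_const assms)

lemma borel_measurable_linear_comb:
  fixes X :: "nat \<Rightarrow> 'v::euclidean_space"
  assumes "\<And>k. k \<in> {1..n} \<Longrightarrow> Q k \<in> borel_measurable M"
  shows "linear_comb n Q X \<in> borel_measurable M"
  unfolding linear_comb_def
  by (intro borel_measurable_sum borel_measurable_scaleR borel_measurable_const assms)

section \<open>Uniform estimates for the reduced model\<close>

text \<open>The number \<open>R\<close> is a real upper bound for the essential supremum in the definition of allowability.\<close>
locale reduced_model =
  fixes M :: "'g measure" and y :: "'g \<Rightarrow> real" and Qa Qu Ql :: "nat \<Rightarrow> 'g \<Rightarrow> real"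
    and na nu nl :: nat
    and A :: "nat \<Rightarrow> real^'r^'r" and B :: "nat \<Rightarrow> real^1^'r" and C :: "nat \<Rightarrow> real^'r^1"
    and xh xd :: "'g \<Rightarrow> real^1^'r" and yh :: "'g \<Rightarrow> real" and R :: real
  assumes y: "y \<in> borel_measurable M" "integrable M (\<lambda>\<mu>. (y \<mu>)\<^sup>2)"
    and Qa: "\<And>q. q \<in> {1..na} \<Longrightarrow> Qa q \<in> borel_measurable M"
    and Qu: "\<And>p. p \<in> {1..nu} \<Longrightarrow> Qu p \<in> borel_measurable M"
    and Ql: "\<And>k. k \<in> {1..nl} \<Longrightarrow> Ql k \<in> borel_measurable M"
    and finite_weight: "(\<integral>\<^sup>+\<mu>. ennreal ((weight nu Qu \<mu> * (\<Sum>k=1..nl. \<bar>Ql k \<mu>\<bar>) / weight na Qa \<mu>)\<^sup>2) \<partial>M) < \<infinity>"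
    and R_nonneg: "0 \<le> R"
    and invertible_A: "AE \<mu> in M. invertible (affine_comb na Qa A \<mu>)"
    and inverse_bound: "AE \<mu> in M. weight na Qa \<mu> * norm (matrix_inv (affine_comb na Qa A \<mu>)) \<le> R"
    and states: "xh \<in> borel_measurable M" "yh \<in> borel_measurable M" "xd \<in> borel_measurable M"
    and primal: "AE \<mu> in M. affine_comb na Qa A \<mu> ** xh \<mu> = affine_comb nu Qu B \<mu>"
    and output_eq: "AE \<mu> in M. yh \<mu> = (linear_comb nl Ql C \<mu> ** xh \<mu>) $ 1 $ 1"
    and dual: "AE \<mu> in M. transpose (affine_comb na Qa A \<mu>) ** xd \<mu> = transpose (linear_comb nl Ql C \<mu>)"
begin

text \<open>The square integrable function whose multiples dominate the output, its gradients with respect to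
  the individual matrices, and the quadratic remainders.\<close>
definition envelope :: "'g \<Rightarrow> real"
  where "envelope \<mu> = weight nu Qu \<mu> * (\<Sum>k=1..nl. \<bar>Ql k \<mu>\<bar>) / weight na Qa \<mu>"

definition model_output :: "(nat \<Rightarrow> real^'r^'r) \<Rightarrow> (nat \<Rightarrow> real^1^'r) \<Rightarrow> (nat \<Rightarrow> real^'r^1) \<Rightarrow> 'g \<Rightarrow> real"
  where "model_output A' B' C' \<mu> = (linear_comb nl Ql C' \<mu> ** matrix_inv (affine_comb na Qa A' \<mu>)
              ** affine_comb nu Qu B' \<mu>) $ 1 $ 1"

definition sum_norm_B :: real where "sum_norm_B = (\<Sum>p=0..nu. norm (B p))"
definition sum_norm_C :: real where "sum_norm_C = (\<Sum>k=1..nl. norm (C k))"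

text \<open>The choice makes \<open>R * radius \<le> 1/2\<close>, the smallness required in \<open>matrix_inv_perturbation\<close>, also when
  \<open>R = 0\<close>.\<close>
definition radius :: real where "radius = 1 / (2 * (R + 1))"

lemma radius: "radius > 0" "R * radius \<le> 1/2"
  using R_nonneg by (auto simp: radius_def field_simps)

lemma envelope_nonneg: "0 \<le> envelope \<mu>"
  unfolding envelope_def using weight_ge_1[of nu Qu \<mu>] weight_ge_1[of na Qa \<mu>] by (simp add: sum_nonneg)

lemma envelope_measurable: "envelope \<in> borel_measurable M"
  unfolding envelope_def[abs_def] weight_def
  by (intro borel_measurable_divide borel_measurable_times borel_measurable_add borel_measurable_sum
      borel_measurable_const borel_measurable_abs Qa Qu Ql)

lemma envelope_square_integrable: "integrable M (\<lambda>\<mu>. (envelope \<mu>)\<^sup>2)"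
proof (rule integrableI_nonneg)
  show "(\<lambda>\<mu>. (envelope \<mu>)\<^sup>2) \<in> borel_measurable M"
    by (intro borel_measurable_power envelope_measurable)
  show "(\<integral>\<^sup>+\<mu>. ennreal ((envelope \<mu>)\<^sup>2) \<partial>M) < \<infinity>"
    unfolding envelope_def by (rule finite_weight)
qed simp

lemma cost_eq: "cost M y na Qa nu Qu nl Ql A' B' C' = (\<integral>\<mu>. (y \<mu> - model_output A' B' C' \<mu>)\<^sup>2 \<partial>M)"
  by (simp add: cost_def cost_integrand_def[abs_def] model_output_def power2_abs)

text \<open>The weight \<open>s\<close> cancels: the perturbation may grow like \<open>s\<close> because the inverse decays like \<open>1/s\<close>.\<close>
lemma perturbed_inverse:
  fixes X E :: "real^'r^'r"
  assumes "invertible X" and s: "1 \<le> s" and "s * norm (matrix_inv X) \<le> R" and E: "norm E \<le> s * radius"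
  shows "norm (matrix_inv X) * norm E \<le> 1/2" and "s * norm (matrix_inv (X + E)) \<le> 2 * R"
proof -
  have "norm (matrix_inv X) * norm E \<le> norm (matrix_inv X) * (s * radius)"
    using E by (rule mult_left_mono) simp
  also have "\<dots> = s * norm (matrix_inv X) * radius" by simp
  also have "\<dots> \<le> R * radius"
    using assms(3) radius by (intro mult_right_mono) auto
  finally show small: "norm (matrix_inv X) * norm E \<le> 1/2" using radius by simp
  have "s * norm (matrix_inv (X + E)) \<le> s * (2 * norm (matrix_inv X))"
    using matrix_inv_perturbation(2)[OF assms(1) small] s by (intro mult_left_mono) auto
  then show "s * norm (matrix_inv (X + E)) \<le> 2 * R" using assms(3) by simp
qed

lemma perturbed_allowable:
  assumes "\<And>q. q \<in> {0..na} \<Longrightarrow> norm (A' q - A q) \<le> radius"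
  shows "AE \<mu> in M. invertible (affine_comb na Qa A' \<mu>)"
    and "AE \<mu> in M. weight na Qa \<mu> * norm (matrix_inv (affine_comb na Qa A' \<mu>)) \<le> 2 * R"
proof -
  have "AE \<mu> in M. invertible (affine_comb na Qa A' \<mu>) \<and>
      weight na Qa \<mu> * norm (matrix_inv (affine_comb na Qa A' \<mu>)) \<le> 2 * R"
    using invertible_A inverse_bound
  proof eventually_elim
    case (elim \<mu>)
    let ?E = "affine_comb na Qa (\<lambda>q. A' q - A q) \<mu>"
    have E: "norm ?E \<le> weight na Qa \<mu> * radius"
      using assms by (rule norm_affine_comb_le)
    note P = perturbed_inverse[OF elim(1) weight_ge_1 elim(2) E]
    show ?case
      unfolding affine_comb_diff[of na Qa A' \<mu> A]
      using P(2) matrix_inv_perturbation(1)[OF elim(1) P(1)] by simp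
  qed
  then show "AE \<mu> in M. invertible (affine_comb na Qa A' \<mu>)"
    "AE \<mu> in M. weight na Qa \<mu> * norm (matrix_inv (affine_comb na Qa A' \<mu>)) \<le> 2 * R" by auto
qed

lemma model_output_measurable: "model_output A' B' C' \<in> borel_measurable M"
  unfolding model_output_def[abs_def]
  by (intro borel_measurable_entry borel_measurable_matrix_mult borel_measurable_affine_comb
      borel_measurable_linear_comb Qa Qu Ql measurable_compose[OF _ borel_measurable_matrix_inv])

text \<open>The weights of \<open>Qu\<close> and \<open>Ql\<close> in the envelope come from \<open>B'\<close> and \<open>C'\<close>, whose sizes enter the
  constant, and the denominator comes from the decay of the inverse.\<close>
lemma model_output_bound:
  assumes "\<And>q. q \<in> {0..na} \<Longrightarrow> norm (A' q - A q) \<le> radius"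
  shows "\<exists>K. AE \<mu> in M. \<bar>model_output A' B' C' \<mu>\<bar> \<le> K * envelope \<mu>"
proof
  let ?b = "\<Sum>p=0..nu. norm (B' p)" and ?c = "\<Sum>k=1..nl. norm (C' k)"
  have inv: "AE \<mu> in M. weight na Qa \<mu> * norm (matrix_inv (affine_comb na Qa A' \<mu>)) \<le> 2 * R"
    using assms by (rule perturbed_allowable)
  show "AE \<mu> in M. \<bar>model_output A' B' C' \<mu>\<bar> \<le> (?c * (2 * R) * ?b) * envelope \<mu>"
    using inv
  proof eventually_elim
    case (elim \<mu>)
    have s: "0 < weight na Qa \<mu>" using weight_ge_1[of na Qa \<mu>] by simp
    have "norm (B' p) \<le> ?b" if "p \<in> {0..nu}" for p
      using that by (intro member_le_sum) auto
    then have b: "norm (affine_comb nu Qu B' \<mu>) \<le> weight nu Qu \<mu> * ?b"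
      by (rule norm_affine_comb_le)
    have "norm (C' k) \<le> ?c" if "k \<in> {1..nl}" for k
      using that by (intro member_le_sum) auto
    then have c: "norm (linear_comb nl Ql C' \<mu>) \<le> (\<Sum>k=1..nl. \<bar>Ql k \<mu>\<bar>) * ?c"
      by (rule norm_linear_comb_le)
    have d: "norm (matrix_inv (affine_comb na Qa A' \<mu>)) \<le> 2 * R / weight na Qa \<mu>"
      using elim s by (simp add: field_simps)
    have "\<bar>model_output A' B' C' \<mu>\<bar> \<le> ((\<Sum>k=1..nl. \<bar>Ql k \<mu>\<bar>) * ?c) * (2 * R / weight na Qa \<mu>) * (weight nu Qu \<mu> * ?b)"
      unfolding model_output_def by (rule order_trans[OF abs_entry_le_norm norm_matrix_mult3_le[OF c d b]])
    also have "\<dots> = (?c * (2 * R) * ?b) * envelope \<mu>" by (simp add: envelope_def)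
    finally show ?case .
  qed
qed

lemma square_error_integrable:
  assumes "\<And>q. q \<in> {0..na} \<Longrightarrow> norm (A' q - A q) \<le> radius"
  shows "integrable M (\<lambda>\<mu>. (y \<mu> - model_output A' B' C' \<mu>)\<^sup>2)"
proof -
  obtain K where K: "AE \<mu> in M. \<bar>model_output A' B' C' \<mu>\<bar> \<le> K * envelope \<mu>" using model_output_bound[OF assms] by blast
  show ?thesis
  proof (rule Bochner_Integration.integrable_bound)
    show "integrable M (\<lambda>\<mu>. 2 * (y \<mu>)\<^sup>2 + 2 * K\<^sup>2 * (envelope \<mu>)\<^sup>2)"
      using y envelope_square_integrable by simp
    show "(\<lambda>\<mu>. (y \<mu> - model_output A' B' C' \<mu>)\<^sup>2) \<in> borel_measurable M"
      using y model_output_measurable by simp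
    show "AE \<mu> in M. norm ((y \<mu> - model_output A' B' C' \<mu>)\<^sup>2) \<le> norm (2 * (y \<mu>)\<^sup>2 + 2 * K\<^sup>2 * (envelope \<mu>)\<^sup>2)"
      using K
    proof eventually_elim
      case (elim \<mu>)
      have "(model_output A' B' C' \<mu>)\<^sup>2 \<le> K\<^sup>2 * (envelope \<mu>)\<^sup>2"
        using power_mono[OF elim abs_ge_zero, of 2] by (simp add: power_mult_distrib)
      moreover have "(y \<mu> - model_output A' B' C' \<mu>)\<^sup>2 \<le> 2 * (y \<mu>)\<^sup>2 + 2 * (model_output A' B' C' \<mu>)\<^sup>2"
        using zero_le_power2[of "y \<mu> + model_output A' B' C' \<mu>"] by (simp add: power2_eq_square algebra_simps)
      ultimately show ?case by simp
    qed
  qed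
qed

lemma cost_well_defined_nearby:
  assumes "\<And>q. q \<in> {0..na} \<Longrightarrow> norm (A' q - A q) \<le> radius"
  shows "cost_well_defined M y na Qa nu Qu nl Ql A' B' C'"
  using perturbed_allowable(1)[OF assms] square_error_integrable[OF assms, where B' = B' and C' = C']
  by (simp add: cost_well_defined_def cost_integrand_def[abs_def] model_output_def)

lemma state_formulas:
  "AE \<mu> in M. xh \<mu> = matrix_inv (affine_comb na Qa A \<mu>) ** affine_comb nu Qu B \<mu>"
  "AE \<mu> in M. transpose (xd \<mu>) = linear_comb nl Ql C \<mu> ** matrix_inv (affine_comb na Qa A \<mu>)"
proof -
  show "AE \<mu> in M. xh \<mu> = matrix_inv (affine_comb na Qa A \<mu>) ** affine_comb nu Qu B \<mu>"
    using invertible_A primal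
  proof eventually_elim
    case (elim \<mu>)
    have "matrix_inv (affine_comb na Qa A \<mu>) ** (affine_comb na Qa A \<mu> ** xh \<mu>) = xh \<mu>"
      by (simp add: matrix_mul_assoc matrix_inv_of_invertible elim(1))
    then show ?case by (simp add: elim(2))
  qed
  show "AE \<mu> in M. transpose (xd \<mu>) = linear_comb nl Ql C \<mu> ** matrix_inv (affine_comb na Qa A \<mu>)"
    using invertible_A dual
  proof eventually_elim
    case (elim \<mu>)
    have C: "transpose (xd \<mu>) ** affine_comb na Qa A \<mu> = linear_comb nl Ql C \<mu>"
      using arg_cong[OF elim(2), of transpose] by (simp add: matrix_transpose_mul)
    have "transpose (xd \<mu>) ** affine_comb na Qa A \<mu> ** matrix_inv (affine_comb na Qa A \<mu>) = transpose (xd \<mu>)"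
      by (simp add: matrix_inv_of_invertible elim(1) flip: matrix_mul_assoc)
    then show ?case by (simp add: C)
  qed
qed

lemma yh_eq_out: "AE \<mu> in M. model_output A B C \<mu> = yh \<mu>"
  using state_formulas(1) output_eq by eventually_elim (simp add: model_output_def matrix_mul_assoc)

lemma cost_eq_output_error: "cost M y na Qa nu Qu nl Ql A B C = (\<integral>\<mu>. \<bar>y \<mu> - yh \<mu>\<bar>\<^sup>2 \<partial>M)"
  unfolding cost_eq power2_abs
  by (rule integral_cong_AE) (use y states model_output_measurable yh_eq_out in auto)

lemma bounds_nonneg: "0 \<le> sum_norm_B" "0 \<le> sum_norm_C"
  by (simp_all add: sum_norm_B_def sum_norm_C_def sum_nonneg)

lemma state_bounds:
  "AE \<mu> in M. norm (xh \<mu>) \<le> R / weight na Qa \<mu> * (weight nu Qu \<mu> * sum_norm_B)"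
  "AE \<mu> in M. norm (xd \<mu>) \<le> (\<Sum>k=1..nl. \<bar>Ql k \<mu>\<bar>) * sum_norm_C * (R / weight na Qa \<mu>)"
proof -
  have inv: "AE \<mu> in M. norm (matrix_inv (affine_comb na Qa A \<mu>)) \<le> R / weight na Qa \<mu>"
    using inverse_bound
  proof eventually_elim
    case (elim \<mu>)
    then show ?case using weight_ge_1[of na Qa \<mu>] by (simp add: field_simps)
  qed
  show "AE \<mu> in M. norm (xh \<mu>) \<le> R / weight na Qa \<mu> * (weight nu Qu \<mu> * sum_norm_B)"
    using inv state_formulas(1)
  proof eventually_elim
    case (elim \<mu>)
    have "norm (B p) \<le> sum_norm_B" if "p \<in> {0..nu}" for p
      using that unfolding sum_norm_B_def by (intro member_le_sum) auto
    then have "norm (affine_comb nu Qu B \<mu>) \<le> weight nu Qu \<mu> * sum_norm_B" by (rule norm_affine_comb_le)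
    with elim(1) show ?case unfolding elim(2)
      by (intro order_trans[OF norm_matrix_mult_le] mult_mono) (auto intro: order_trans[OF norm_ge_zero])
  qed
  show "AE \<mu> in M. norm (xd \<mu>) \<le> (\<Sum>k=1..nl. \<bar>Ql k \<mu>\<bar>) * sum_norm_C * (R / weight na Qa \<mu>)"
    using inv state_formulas(2)
  proof eventually_elim
    case (elim \<mu>)
    have "norm (C k) \<le> sum_norm_C" if "k \<in> {1..nl}" for k
      using that unfolding sum_norm_C_def by (intro member_le_sum) auto
    then have "norm (linear_comb nl Ql C \<mu>) \<le> (\<Sum>k=1..nl. \<bar>Ql k \<mu>\<bar>) * sum_norm_C" by (rule norm_linear_comb_le)
    with elim(1) have "norm (transpose (xd \<mu>)) \<le> (\<Sum>k=1..nl. \<bar>Ql k \<mu>\<bar>) * sum_norm_C * (R / weight na Qa \<mu>)"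
      unfolding elim(2)
      by (intro order_trans[OF norm_matrix_mult_le] mult_mono) (auto intro: order_trans[OF norm_ge_zero])
    then show ?case by (simp add: norm_transpose)
  qed
qed

text \<open>Both states carry a factor \<open>1/s\<close>, where \<open>s\<close> is the weight of \<open>Qa\<close>. One is absorbed by the envelope, and
  the other is left over to compensate the coefficient by which a perturbation of \<open>A\<close> is multiplied.\<close>
lemma state_product_bound:
  "AE \<mu> in M. norm (xd \<mu>) * norm (xh \<mu>) \<le> sum_norm_C * sum_norm_B * R\<^sup>2 * envelope \<mu> / weight na Qa \<mu>"
  using state_bounds
proof eventually_elim
  case (elim \<mu>)
  have "norm (xd \<mu>) * norm (xh \<mu>) \<le>
      ((\<Sum>k=1..nl. \<bar>Ql k \<mu>\<bar>) * sum_norm_C * (R / weight na Qa \<mu>)) * (R / weight na Qa \<mu> * (weight nu Qu \<mu> * sum_norm_B))"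
    using elim by (intro mult_mono) (auto intro: order_trans[OF norm_ge_zero])
  also have "\<dots> = sum_norm_C * sum_norm_B * R\<^sup>2 * envelope \<mu> / weight na Qa \<mu>"
    by (simp add: envelope_def power2_eq_square)
  finally show ?case .
qed

section \<open>The gradients\<close>

lemma gradient_A:
  assumes q: "q \<le> na"
  shows "integrable M (\<lambda>\<mu>. (affine_coeff Qa q \<mu> * (y \<mu> - yh \<mu>)) *\<^sub>R (xd \<mu> ** transpose (xh \<mu>)))" (is ?int)
    and "GDERIV (\<lambda>X. cost M y na Qa nu Qu nl Ql (A(q := X)) B C) (A q) :>
         2 *\<^sub>R (\<integral>\<mu>. (affine_coeff Qa q \<mu> * (y \<mu> - yh \<mu>)) *\<^sub>R (xd \<mu> ** transpose (xh \<mu>)) \<partial>M)" (is ?deriv)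
proof -
  let ?g = "\<lambda>\<mu>. - affine_coeff Qa q \<mu> *\<^sub>R (xd \<mu> ** transpose (xh \<mu>))"
  let ?s = "weight na Qa"
  \<comment> \<open>The first summand bounds the gradient of the output, the second its quadratic remainder.\<close>
  define K where "K = sum_norm_C * sum_norm_B * R\<^sup>2 * (1 + 2 * R)"
  have P: "0 \<le> sum_norm_C * sum_norm_B * R\<^sup>2" using bounds_nonneg by simp
  have K: "0 \<le> K" "sum_norm_C * sum_norm_B * R\<^sup>2 \<le> K" "sum_norm_C * sum_norm_B * R\<^sup>2 * (2 * R) \<le> K"
    using P R_nonneg unfolding K_def by (auto simp: algebra_simps)
  have near: "norm ((A(q := A q + h)) j - A j) \<le> radius" if "norm h < radius" for h j
    using that radius by auto
  have g_meas: "?g \<in> borel_measurable M"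
    using q by (intro borel_measurable_scaleR borel_measurable_matrix_mult borel_measurable_transpose
        states borel_measurable_uminus borel_measurable_affine_coeff Qa)
  have g: "AE \<mu> in M. norm (?g \<mu>) \<le> K * envelope \<mu>"
    using state_product_bound
  proof eventually_elim
    case (elim \<mu>)
    have s: "?s \<mu> > 0" using weight_ge_1[of na Qa \<mu>] by simp
    have "norm (?g \<mu>) \<le> \<bar>affine_coeff Qa q \<mu>\<bar> * (norm (xd \<mu>) * norm (xh \<mu>))"
      using norm_matrix_mult_le[of "xd \<mu>" "transpose (xh \<mu>)"] by (simp add: norm_transpose mult_left_mono)
    also have "\<dots> \<le> ?s \<mu> * (sum_norm_C * sum_norm_B * R\<^sup>2 * envelope \<mu> / ?s \<mu>)"
      using abs_affine_coeff_le_weight[OF q] elim s by (intro mult_mono) auto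
    also have "\<dots> = sum_norm_C * sum_norm_B * R\<^sup>2 * envelope \<mu>" using s by simp
    also have "\<dots> \<le> K * envelope \<mu>" using K envelope_nonneg by (intro mult_right_mono)
    finally show ?case .
  qed
  have lin: "AE \<mu> in M. \<bar>model_output (A(q := A q + h)) B C \<mu> - yh \<mu> - h \<bullet> ?g \<mu>\<bar> \<le> K * envelope \<mu> * (norm h)\<^sup>2"
    if h: "norm h < radius" for h
    using invertible_A inverse_bound state_formulas yh_eq_out state_product_bound
  proof eventually_elim
    case (elim \<mu>)
    let ?A = "affine_comb na Qa A \<mu>" and ?B = "affine_comb nu Qu B \<mu>" and ?C = "linear_comb nl Ql C \<mu>"
    let ?E = "affine_coeff Qa q \<mu> *\<^sub>R h"
    let ?D = "matrix_inv ?A" and ?D' = "matrix_inv (?A + ?E)"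
    have s: "?s \<mu> > 0" using weight_ge_1[of na Qa \<mu>] by simp
    have E: "norm ?E \<le> ?s \<mu> * norm h"
      using abs_affine_coeff_le_weight[OF q, of Qa \<mu>] by (simp add: mult_right_mono)
    also have "\<dots> \<le> ?s \<mu> * radius" using h s by simp
    finally have E': "norm ?E \<le> ?s \<mu> * radius" .
    note inv = perturbed_inverse[OF elim(1) weight_ge_1 elim(2) E']
    have D': "norm ?D' \<le> 2 * R / ?s \<mu>" using inv(2) s by (simp add: field_simps)
    \<comment> \<open>The outer factors \<open>?C ** ?D\<close> and \<open>?D ** ?B\<close> of the expansion are the dual and the primal state.\<close>
    have "?C ** ?D' ** ?B = ?C ** ?D ** ?B - ?C ** ?D ** ?E ** ?D ** ?B + ?C ** ?D ** ?E ** ?D' ** ?E ** ?D ** ?B"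
      by (subst matrix_inv_perturbation(4)[OF elim(1) inv(1)])
        (simp add: matmul.add_left matmul.diff_left matmul.add_right matmul.diff_right matrix_mul_assoc)
    also have "\<dots> = ?C ** ?D ** ?B - transpose (xd \<mu>) ** ?E ** xh \<mu> + transpose (xd \<mu>) ** (?E ** ?D' ** ?E) ** xh \<mu>"
      by (simp add: elim(3,4) matrix_mul_assoc)
    finally have "model_output (A(q := A q + h)) B C \<mu> - yh \<mu> - h \<bullet> ?g \<mu>
        = (transpose (xd \<mu>) ** (?E ** ?D' ** ?E) ** xh \<mu>) $ 1 $ 1"
      using elim(5) by (simp add: model_output_def affine_comb_update[OF q] inner_rank_one matmul.scaleR_left matmul.scaleR_right)
    then have "\<bar>model_output (A(q := A q + h)) B C \<mu> - yh \<mu> - h \<bullet> ?g \<mu>\<bar>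
        \<le> norm (transpose (xd \<mu>) ** (?E ** ?D' ** ?E) ** xh \<mu>)"
      by (simp add: abs_entry_le_norm)
    also have "\<dots> \<le> norm (xd \<mu>) * ((?s \<mu> * norm h) * (2 * R / ?s \<mu>) * (?s \<mu> * norm h)) * norm (xh \<mu>)"
      by (intro norm_matrix_mult3_le E D') (simp_all add: norm_transpose)
    also have "\<dots> = (norm (xd \<mu>) * norm (xh \<mu>)) * (?s \<mu> * (2 * R) * (norm h)\<^sup>2)"
      using s by (simp add: power2_eq_square)
    also have "\<dots> \<le> (sum_norm_C * sum_norm_B * R\<^sup>2 * envelope \<mu> / ?s \<mu>) * (?s \<mu> * (2 * R) * (norm h)\<^sup>2)"
      using elim(6) s R_nonneg by (intro mult_right_mono) auto
    also have "\<dots> = sum_norm_C * sum_norm_B * R\<^sup>2 * (2 * R) * (envelope \<mu> * (norm h)\<^sup>2)"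
      using s by simp
    also have "\<dots> \<le> K * (envelope \<mu> * (norm h)\<^sup>2)"
      using K envelope_nonneg by (intro mult_right_mono) auto
    finally show ?case by (simp add: mult.assoc)
  qed
  note grad = GDERIV_mean_square[where Y = "\<lambda>X. model_output (A(q := X)) B C" and ?X0.0 = "A q",
      OF radius(1) K(1) y(1) states(2) g_meas envelope_measurable envelope_nonneg envelope_square_integrable _
        square_error_integrable[OF near] g lin]
  have "(yh \<mu> - y \<mu>) *\<^sub>R ?g \<mu> = (affine_coeff Qa q \<mu> * (y \<mu> - yh \<mu>)) *\<^sub>R (xd \<mu> ** transpose (xh \<mu>))" for \<mu>
    by (simp add: algebra_simps flip: scaleR_minus_left)
  then show ?int ?deriv
    using grad yh_eq_out by (simp_all add: cost_eq)
qed

lemma gradient_B: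
  assumes p: "p \<le> nu"
  shows "integrable M (\<lambda>\<mu>. (affine_coeff Qu p \<mu> * (yh \<mu> - y \<mu>)) *\<^sub>R xd \<mu>)" (is ?int)
    and "GDERIV (\<lambda>X. cost M y na Qa nu Qu nl Ql A (B(p := X)) C) (B p) :>
         2 *\<^sub>R (\<integral>\<mu>. (affine_coeff Qu p \<mu> * (yh \<mu> - y \<mu>)) *\<^sub>R xd \<mu> \<partial>M)" (is ?deriv)
proof -
  let ?g = "\<lambda>\<mu>. affine_coeff Qu p \<mu> *\<^sub>R xd \<mu>"
  have K: "0 \<le> sum_norm_C * R" using bounds_nonneg R_nonneg by simp
  have g_meas: "?g \<in> borel_measurable M"
    using p by (intro borel_measurable_scaleR states borel_measurable_affine_coeff Qu)
  have g: "AE \<mu> in M. norm (?g \<mu>) \<le> sum_norm_C * R * envelope \<mu>"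
    using state_bounds(2)
  proof eventually_elim
    case (elim \<mu>)
    have "norm (?g \<mu>) \<le> weight nu Qu \<mu> * ((\<Sum>k=1..nl. \<bar>Ql k \<mu>\<bar>) * sum_norm_C * (R / weight na Qa \<mu>))"
      using abs_affine_coeff_le_weight[OF p, of Qu \<mu>] elim weight_ge_1[of nu Qu \<mu>] unfolding norm_scaleR
      by (intro mult_mono) auto
    then show ?case by (simp add: envelope_def mult_ac)
  qed
  have lin: "AE \<mu> in M. \<bar>model_output A (B(p := B p + h)) C \<mu> - yh \<mu> - h \<bullet> ?g \<mu>\<bar> \<le> sum_norm_C * R * envelope \<mu> * (norm h)\<^sup>2" for h
    using state_formulas(2) yh_eq_out
  proof eventually_elim
    case (elim \<mu>)
    have "model_output A (B(p := B p + h)) C \<mu> - yh \<mu> - h \<bullet> ?g \<mu> = 0"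
      using elim(2) by (simp add: model_output_def affine_comb_update[OF p] inner_column matmul.add_right
          matmul.scaleR_right matmul.scaleR_left transpose_scalar flip: elim(1))
    then show ?case using K envelope_nonneg[of \<mu>] by simp
  qed
  note grad = GDERIV_mean_square[where Y = "\<lambda>X. model_output A (B(p := X)) C" and ?X0.0 = "B p",
      OF radius(1) K y(1) states(2) g_meas envelope_measurable envelope_nonneg envelope_square_integrable _
        square_error_integrable g lin]
  show ?int ?deriv
    using grad yh_eq_out radius(1) by (simp_all add: cost_eq mult.commute)
qed

lemma gradient_C:
  assumes k: "k \<in> {1..nl}"
  shows "integrable M (\<lambda>\<mu>. (Ql k \<mu> * (yh \<mu> - y \<mu>)) *\<^sub>R transpose (xh \<mu>))" (is ?int)
    and "GDERIV (\<lambda>X. cost M y na Qa nu Qu nl Ql A B (C(k := X))) (C k) :>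
         2 *\<^sub>R (\<integral>\<mu>. (Ql k \<mu> * (yh \<mu> - y \<mu>)) *\<^sub>R transpose (xh \<mu>) \<partial>M)" (is ?deriv)
proof -
  let ?g = "\<lambda>\<mu>. Ql k \<mu> *\<^sub>R transpose (xh \<mu>)"
  have K: "0 \<le> sum_norm_B * R" using bounds_nonneg R_nonneg by simp
  have g_meas: "?g \<in> borel_measurable M"
    using k by (intro borel_measurable_scaleR borel_measurable_transpose states Ql)
  have g: "AE \<mu> in M. norm (?g \<mu>) \<le> sum_norm_B * R * envelope \<mu>"
    using state_bounds(1)
  proof eventually_elim
    case (elim \<mu>)
    have "\<bar>Ql k \<mu>\<bar> \<le> (\<Sum>k=1..nl. \<bar>Ql k \<mu>\<bar>)"
      using k by (intro member_le_sum) auto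
    then have "norm (?g \<mu>) \<le> (\<Sum>k=1..nl. \<bar>Ql k \<mu>\<bar>) * (R / weight na Qa \<mu> * (weight nu Qu \<mu> * sum_norm_B))"
      using elim unfolding norm_scaleR norm_transpose by (intro mult_mono) (auto simp: sum_nonneg)
    then show ?case by (simp add: envelope_def mult_ac)
  qed
  have lin: "AE \<mu> in M. \<bar>model_output A B (C(k := C k + h)) \<mu> - yh \<mu> - h \<bullet> ?g \<mu>\<bar> \<le> sum_norm_B * R * envelope \<mu> * (norm h)\<^sup>2" for h
    using state_formulas(1) yh_eq_out
  proof eventually_elim
    case (elim \<mu>)
    have "model_output A B (C(k := C k + h)) \<mu> - yh \<mu> - h \<bullet> ?g \<mu> = 0"
      using elim(2) by (simp add: model_output_def linear_comb_update[OF k] inner_row matmul.add_left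
          matmul.scaleR_left flip: elim(1) matrix_mul_assoc)
    then show ?case using K envelope_nonneg[of \<mu>] by simp
  qed
  note grad = GDERIV_mean_square[where Y = "\<lambda>X. model_output A B (C(k := X))" and ?X0.0 = "C k",
      OF radius(1) K y(1) states(2) g_meas envelope_measurable envelope_nonneg envelope_square_integrable _
        square_error_integrable g lin]
  show ?int ?deriv
    using grad yh_eq_out radius(1) by (simp_all add: cost_eq mult.commute)
qed

end

theorem theorem3p5:
  fixes M :: "'g measure"
    and y :: "'g \<Rightarrow> real"
    and Qa Qu Ql :: "nat \<Rightarrow> 'g \<Rightarrow> real"
    and na nu nl :: nat
    and \<beta> :: real
    and A :: "nat \<Rightarrow> real^('n1::finite + 'n2::finite + 'n2)^('n1 + 'n2 + 'n2)"
    and B :: "nat \<Rightarrow> real^1^('n1 + 'n2 + 'n2)"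
    and C :: "nat \<Rightarrow> real^('n1 + 'n2 + 'n2)^1"
    and xh xd :: "'g \<Rightarrow> real^1^('n1 + 'n2 + 'n2)"
    and yh :: "'g \<Rightarrow> real"
  assumes "y \<in> borel_measurable M" and "integrable M (\<lambda>\<mu>. (y \<mu>)\<^sup>2)"
    and "na \<ge> 1" and "nu \<ge> 1" and "nl \<ge> 1"
    and "\<And>q. q \<in> {1..na} \<Longrightarrow> Qa q \<in> borel_measurable M"
    and "\<And>p. p \<in> {1..nu} \<Longrightarrow> Qu p \<in> borel_measurable M"
    and "\<And>k. k \<in> {1..nl} \<Longrightarrow> Ql k \<in> borel_measurable M"
    and "(\<integral>\<^sup>+\<mu>. ennreal (((1 + (\<Sum>p=1..nu. \<bar>Qu p \<mu>\<bar>)) * (\<Sum>k=1..nl. \<bar>Ql k \<mu>\<bar>)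
                     / (1 + (\<Sum>q=1..na. \<bar>Qa q \<mu>\<bar>)))\<^sup>2) \<partial>M) < \<infinity>"
    and "\<beta> > 0"
    and "(A, B, C) \<in> allowable_set M \<beta> na Qa nu"
    and "xh \<in> borel_measurable M" and "yh \<in> borel_measurable M" and "xd \<in> borel_measurable M"
    and "AE \<mu> in M. affine_comb na Qa A \<mu> ** xh \<mu> = affine_comb nu Qu B \<mu>"
    and "AE \<mu> in M. yh \<mu> = (linear_comb nl Ql C \<mu> ** xh \<mu>) $ 1 $ 1"
    and "AE \<mu> in M. transpose (affine_comb na Qa A \<mu>) ** xd \<mu> = transpose (linear_comb nl Ql C \<mu>)"
  shows
    "(\<exists>\<epsilon>>0. \<forall>A' B' C'.
        (\<forall>q\<in>{0..na}. norm (A' q - A q) < \<epsilon>) \<and> (\<forall>p\<in>{0..nu}. norm (B' p - B p) < \<epsilon>) \<and>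
        (\<forall>k\<in>{1..nl}. norm (C' k - C k) < \<epsilon>)
        \<longrightarrow> cost_well_defined M y na Qa nu Qu nl Ql A' B' C') \<and>
     cost M y na Qa nu Qu nl Ql A B C = (\<integral>\<mu>. \<bar>y \<mu> - yh \<mu>\<bar>\<^sup>2 \<partial>M) \<and>
     (integrable M (\<lambda>\<mu>. (y \<mu> - yh \<mu>) *\<^sub>R (xd \<mu> ** transpose (xh \<mu>))) \<and>
      (GDERIV (\<lambda>X. cost M y na Qa nu Qu nl Ql (A(0 := X)) B C) (A 0) :>
         2 *\<^sub>R (\<integral>\<mu>. (y \<mu> - yh \<mu>) *\<^sub>R (xd \<mu> ** transpose (xh \<mu>)) \<partial>M))) \<and>
     (\<forall>q\<in>{1..na}.
        integrable M (\<lambda>\<mu>. (Qa q \<mu> * (y \<mu> - yh \<mu>)) *\<^sub>R (xd \<mu> ** transpose (xh \<mu>))) \<and>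
        (GDERIV (\<lambda>X. cost M y na Qa nu Qu nl Ql (A(q := X)) B C) (A q) :>
           2 *\<^sub>R (\<integral>\<mu>. (Qa q \<mu> * (y \<mu> - yh \<mu>)) *\<^sub>R (xd \<mu> ** transpose (xh \<mu>)) \<partial>M))) \<and>
     (integrable M (\<lambda>\<mu>. (yh \<mu> - y \<mu>) *\<^sub>R xd \<mu>) \<and>
      (GDERIV (\<lambda>X. cost M y na Qa nu Qu nl Ql A (B(0 := X)) C) (B 0) :>
         2 *\<^sub>R (\<integral>\<mu>. (yh \<mu> - y \<mu>) *\<^sub>R xd \<mu> \<partial>M))) \<and>
     (\<forall>p\<in>{1..nu}.
        integrable M (\<lambda>\<mu>. (Qu p \<mu> * (yh \<mu> - y \<mu>)) *\<^sub>R xd \<mu>) \<and>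
        (GDERIV (\<lambda>X. cost M y na Qa nu Qu nl Ql A (B(p := X)) C) (B p) :>
           2 *\<^sub>R (\<integral>\<mu>. (Qu p \<mu> * (yh \<mu> - y \<mu>)) *\<^sub>R xd \<mu> \<partial>M))) \<and>
     (\<forall>k\<in>{1..nl}.
        integrable M (\<lambda>\<mu>. (Ql k \<mu> * (yh \<mu> - y \<mu>)) *\<^sub>R transpose (xh \<mu>)) \<and>
        (GDERIV (\<lambda>X. cost M y na Qa nu Qu nl Ql A B (C(k := X))) (C k) :>
           2 *\<^sub>R (\<integral>\<mu>. (Ql k \<mu> * (yh \<mu> - y \<mu>)) *\<^sub>R transpose (xh \<mu>) \<partial>M)))"
proof -
  let ?A = "affine_comb na Qa A"
  have invertible: "AE \<mu> in M. invertible (?A \<mu>)"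
    and ess: "esssup M (\<lambda>\<mu>. ereal (weight na Qa \<mu> * norm (matrix_inv (?A \<mu>)))) < \<infinity>"
    using assms(11) unfolding allowable_set_def weight_def by auto
  \<comment> \<open>A natural number above the essential supremum is used as the bound, since the essential supremum
    itself is \<open>-\<infinity>\<close> when the measure is zero.\<close>
  obtain n :: nat where n: "esssup M (\<lambda>\<mu>. ereal (weight na Qa \<mu> * norm (matrix_inv (?A \<mu>)))) < ereal (real n)"
    using ess less_PInf_Ex_of_nat by auto
  have inverse_bound: "AE \<mu> in M. weight na Qa \<mu> * norm (matrix_inv (?A \<mu>)) \<le> real n"
    using esssup_AE[of "\<lambda>\<mu>. ereal (weight na Qa \<mu> * norm (matrix_inv (?A \<mu>)))" M]
  proof eventually_elim
    case (elim \<mu>)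
    then show ?case using le_less_trans[OF elim n] by simp
  qed
  interpret reduced_model M y Qa Qu Ql na nu nl A B C xh xd yh "real n"
    by (unfold_locales; fact assms(1,2,6-8,12-17) assms(9)[folded weight_def] of_nat_0_le_iff
        invertible inverse_bound)
  show ?thesis
  proof (intro conjI ballI)
    show "\<exists>\<epsilon>>0. \<forall>A' B' C'.
        (\<forall>q\<in>{0..na}. norm (A' q - A q) < \<epsilon>) \<and> (\<forall>p\<in>{0..nu}. norm (B' p - B p) < \<epsilon>) \<and>
        (\<forall>k\<in>{1..nl}. norm (C' k - C k) < \<epsilon>)
        \<longrightarrow> cost_well_defined M y na Qa nu Qu nl Ql A' B' C'"
    proof (intro exI[of _ radius] conjI allI impI radius(1))
      fix A' B' C'
      assume "(\<forall>q\<in>{0..na}. norm (A' q - A q) < radius) \<and> (\<forall>p\<in>{0..nu}. norm (B' p - B p) < radius) \<and>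
        (\<forall>k\<in>{1..nl}. norm (C' k - C k) < radius)"
      then show "cost_well_defined M y na Qa nu Qu nl Ql A' B' C'"
        by (intro cost_well_defined_nearby) (auto intro: less_imp_le)
    qed
    show "cost M y na Qa nu Qu nl Ql A B C = (\<integral>\<mu>. \<bar>y \<mu> - yh \<mu>\<bar>\<^sup>2 \<partial>M)"
      by (rule cost_eq_output_error)
    note A0 = gradient_A[OF le0, unfolded affine_coeff_0 mult_1]
    note B0 = gradient_B[OF le0, unfolded affine_coeff_0 mult_1]
    show "integrable M (\<lambda>\<mu>. (y \<mu> - yh \<mu>) *\<^sub>R (xd \<mu> ** transpose (xh \<mu>)))"
      and "GDERIV (\<lambda>X. cost M y na Qa nu Qu nl Ql (A(0 := X)) B C) (A 0) :>
         2 *\<^sub>R (\<integral>\<mu>. (y \<mu> - yh \<mu>) *\<^sub>R (xd \<mu> ** transpose (xh \<mu>)) \<partial>M)"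
      by (fact A0)+
    show "integrable M (\<lambda>\<mu>. (yh \<mu> - y \<mu>) *\<^sub>R xd \<mu>)"
      and "GDERIV (\<lambda>X. cost M y na Qa nu Qu nl Ql A (B(0 := X)) C) (B 0) :>
         2 *\<^sub>R (\<integral>\<mu>. (yh \<mu> - y \<mu>) *\<^sub>R xd \<mu> \<partial>M)"
      by (fact B0)+
  next
    fix q assume q: "q \<in> {1..na}"
    then have "q \<le> na" by simp
    note Aq = gradient_A[OF this, unfolded affine_coeff_of_pos[OF q]]
    show "integrable M (\<lambda>\<mu>. (Qa q \<mu> * (y \<mu> - yh \<mu>)) *\<^sub>R (xd \<mu> ** transpose (xh \<mu>)))"
      and "GDERIV (\<lambda>X. cost M y na Qa nu Qu nl Ql (A(q := X)) B C) (A q) :>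
           2 *\<^sub>R (\<integral>\<mu>. (Qa q \<mu> * (y \<mu> - yh \<mu>)) *\<^sub>R (xd \<mu> ** transpose (xh \<mu>)) \<partial>M)"
      by (fact Aq)+
  next
    fix p assume p: "p \<in> {1..nu}"
    then have "p \<le> nu" by simp
    note Bp = gradient_B[OF this, unfolded affine_coeff_of_pos[OF p]]
    show "integrable M (\<lambda>\<mu>. (Qu p \<mu> * (yh \<mu> - y \<mu>)) *\<^sub>R xd \<mu>)"
      and "GDERIV (\<lambda>X. cost M y na Qa nu Qu nl Ql A (B(p := X)) C) (B p) :>
           2 *\<^sub>R (\<integral>\<mu>. (Qu p \<mu> * (yh \<mu> - y \<mu>)) *\<^sub>R xd \<mu> \<partial>M)"
      by (fact Bp)+
  next
    fix k assume "k \<in> {1..nl}"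
    note Ck = gradient_C[OF this]
    show "integrable M (\<lambda>\<mu>. (Ql k \<mu> * (yh \<mu> - y \<mu>)) *\<^sub>R transpose (xh \<mu>))"
      and "GDERIV (\<lambda>X. cost M y na Qa nu Qu nl Ql A B (C(k := X))) (C k) :>
           2 *\<^sub>R (\<integral>\<mu>. (Ql k \<mu> * (yh \<mu> - y \<mu>)) *\<^sub>R transpose (xh \<mu>) \<partial>M)"
      by (fact Ck)+
  qed
qed

end
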